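(* There exist absolute constants $C>0$ and $\epsilon_0>0$, for each $0<\epsilon<\epsilon_0$ a threshold $Q_0(\epsilon)$ depending only on $\epsilon$, and for each $\delta>0$ and $0<\epsilon<\epsilon_0$ a constant $c(\delta,\epsilon)>0$ depending only on $\delta,\epsilon$, such that the following holds. For all real-valued $\phi\in C^2([0,1])$, all $\delta>0$, all $0<\epsilon<\epsilon_0$ and all real $Q\ge Q_0(\epsilon)$, there exist $g\in\mathrm{SL}_2(\mathbb R)$ with $\max_{i,j}|g_{ij}-\delta_{ij}|\le C\delta$ (where $\delta_{ij}$ is the Kronecker delta) and $\phi_g\in C^2([0,1])$ with $\|\phi-\phi_g\|_{C^2}\le C\epsilon$ for which $$\bigl|g\mathcal M_{\phi_g}\cap Q^{-1}\mathbb Z^2\bigr|\ \ge\ c(\delta,\epsilon)\,Q^{2/3}.$$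
   Context: For $\phi\in C^2([0,1])$, $\mathcal M_\phi=\{(\xi,\phi(\xi)):\xi\in[0,1]\}\subset\mathbb R^2$ is its graph, and $g\mathcal M_\phi$ is its image under the linear map $g$. $|\cdot|$ of a set denotes cardinality. The norm is $\|\phi\|_{C^2}=\max_{0\le k\le2}\sup_{x\in[0,1]}|\phi^{(k)}(x)|$. *)

theory Defs
  imports "HOL-Analysis.Analysis"
begin

(* Functions on [0,1] are modelled as total functions real => real of which only the values on
   {0..1} matter. Derivatives are taken within {0..1}, hence are one-sided at 0 and 1. *)
definition deriv01 :: "nat \<Rightarrow> (real \<Rightarrow> real) \<Rightarrow> real \<Rightarrow> real" where
  "deriv01 k f = ((\<lambda>h x. vector_derivative h (at x within {0..1})) ^^ k) f"

definition C2_01 :: "(real \<Rightarrow> real) \<Rightarrow> bool" where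
  "C2_01 f \<longleftrightarrow>
     (\<forall>k<2. deriv01 k f differentiable_on {0..1}) \<and> continuous_on {0..1} (deriv01 2 f)"

(* Meaningful for f with C2_01 f only: otherwise the suprema or derivatives may be junk values. *)
definition C2_norm :: "(real \<Rightarrow> real) \<Rightarrow> real" where
  "C2_norm f = (MAX k\<in>{0..2}. SUP x\<in>{0..1}. \<bar>deriv01 k f x\<bar>)"

definition graph01 :: "(real \<Rightarrow> real) \<Rightarrow> (real^2) set" where
  "graph01 f = {vector [\<xi>, f \<xi>] | \<xi>. \<xi> \<in> {0..1}}"

definition SL2 :: "(real^2^2) set" where
  "SL2 = {g. det g = 1}"

definition int_lattice :: "(real^2) set" where
  "int_lattice = {z. \<forall>i. z $ i \<in> \<int>}"

definition scaled_lattice :: "real \<Rightarrow> (real^2) set" where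
  "scaled_lattice Q = (\<lambda>z. inverse Q *\<^sub>R z) ` int_lattice"

end

theory Submission
  imports Defs "HOL-Computational_Algebra.Primes"
begin

text \<open>The matrix \<open>g\<close> can be taken to be the identity: adding an affine function with coefficients at
  most \<open>\<epsilon>\<close> is already a \<open>C\<^sup>2\<close> perturbation of size \<open>\<epsilon>\<close>, and it provides all the averaging that
  is needed.

  Let \<open>m\<close> be about \<open>1 / \<epsilon>\<close> and \<open>H\<close> about \<open>Q powr (1 / 3)\<close>, and consider the abscissae
  \<open>m * b / Q\<close> in the unit interval, with \<open>b\<close> in blocks of \<open>H\<close> consecutive integers separated by gaps
  of length \<open>H\<close>. The number of blocks is of order \<open>\<epsilon> * Q powr (2 / 3)\<close>. Replacing \<open>\<phi> x\<close> by
  \<open>\<phi> x + \<theta> / Q + (t / m) * x\<close> with \<open>\<theta>\<close> and \<open>t\<close> between 0 and 1 adds \<open>\<theta> + t * b\<close> to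
  \<open>Q * \<phi> (m * b / Q)\<close>. For random \<open>\<theta>\<close> and \<open>t\<close> these values are uniform modulo 1 and pairwise
  independent inside a block, so a block contains a value within \<open>1 / H\<close> above an integer with
  probability bounded below. Hence one choice of \<open>\<theta>\<close> and \<open>t\<close> serves a positive proportion of the
  blocks (\<open>exists_affine_shift_near_integers\<close>). Nothing about \<open>\<phi>\<close> is used here, which
  is why all constants are independent of it.

  It remains to lower the function by at most \<open>1 / (H * Q)\<close> at one point in each of these blocks. The
  points are \<open>m * H / Q\<close> apart, so disjoint bumps of that width do it, with second derivatives of
  order \<open>Q / (m\<^sup>2 * H ^ 3)\<close>, which is at most \<open>\<epsilon>\<close> (\<open>bump_interpolation\<close>).\<close>

section \<open>Twice continuously differentiable functions on the unit interval\<close>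

text \<open>\<open>f1\<close> and \<open>f2\<close> are the first and second one-sided derivatives of \<open>f\<close> on the unit
  interval, and \<open>f2\<close> is continuous there. Carrying the derivatives explicitly avoids computing with
  the choice operator inside \<^const>\<open>vector_derivative\<close>.\<close>
definition C2_derivs :: "(real \<Rightarrow> real) \<Rightarrow> (real \<Rightarrow> real) \<Rightarrow> (real \<Rightarrow> real) \<Rightarrow> bool" where
  "C2_derivs f f1 f2 \<longleftrightarrow>
     (\<forall>x\<in>{0..1}. (f has_real_derivative f1 x) (at x within {0..1})) \<and>
     (\<forall>x\<in>{0..1}. (f1 has_real_derivative f2 x) (at x within {0..1})) \<and>
     continuous_on {0..1} f2"

lemma deriv01_simps:
  "deriv01 0 f = f"
  "deriv01 (Suc 0) f = (\<lambda>x. vector_derivative f (at x within {0..1}))"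
  "deriv01 2 f = (\<lambda>x. vector_derivative (deriv01 (Suc 0) f) (at x within {0..1}))"
  by (simp_all add: deriv01_def numeral_2_eq_2)

lemma vector_derivative_01:
  fixes f :: "real \<Rightarrow> real"
  assumes "(f has_real_derivative d) (at x within {0..1})" "x \<in> {0..1}"
  shows "vector_derivative f (at x within {0..1}) = d"
  using assms vector_derivative_within_cbox[of 0 1 x f d]
  by (simp add: has_real_derivative_iff_has_vector_derivative)

lemma C2_derivs_deriv01:
  assumes "C2_derivs f f1 f2" "x \<in> {0..1}"
  shows "deriv01 (Suc 0) f x = f1 x" and "deriv01 2 f x = f2 x"
proof -
  have *: "deriv01 (Suc 0) f y = f1 y" if "y \<in> {0..1}" for y
    using assms(1) that by (simp add: deriv01_simps C2_derivs_def vector_derivative_01)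
  show "deriv01 (Suc 0) f x = f1 x" using * assms(2) .
  have "(f1 has_real_derivative f2 x) (at x within {0..1})"
    using assms by (simp add: C2_derivs_def)
  then have "(deriv01 (Suc 0) f has_real_derivative f2 x) (at x within {0..1})"
    using * assms(2) by (auto intro: has_field_derivative_transform_within[OF _ zero_less_one])
  then show "deriv01 2 f x = f2 x"
    using assms(2) by (simp add: deriv01_simps(3) vector_derivative_01)
qed

lemma C2_01_iff_C2_derivs: "C2_01 f \<longleftrightarrow> (\<exists>f1 f2. C2_derivs f f1 f2)"
proof
  assume f: "C2_01 f"
  have *: "(h has_real_derivative vector_derivative h (at x within {0..1})) (at x within {0..1})"
    if "h differentiable_on {0..1}" "x \<in> {0..1}" for h :: "real \<Rightarrow> real" and x
    using that
    by (simp add: has_real_derivative_iff_has_vector_derivative differentiable_on_def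
        vector_derivative_works[symmetric])
  have "deriv01 0 f differentiable_on {0..1}" "deriv01 (Suc 0) f differentiable_on {0..1}"
    using f unfolding C2_01_def by (metis pos2, metis lessI numeral_2_eq_2)
  then have "C2_derivs f (deriv01 (Suc 0) f) (deriv01 2 f)"
    using f *[of f] *[of "deriv01 (Suc 0) f"]
    by (simp add: C2_derivs_def C2_01_def deriv01_simps)
  then show "\<exists>f1 f2. C2_derivs f f1 f2" by blast
next
  assume "\<exists>f1 f2. C2_derivs f f1 f2"
  then obtain f1 f2 where f: "C2_derivs f f1 f2" by blast
  have diff: "h differentiable_on {0..1}"
    if "\<forall>x\<in>{0..1}. (h has_real_derivative h' x) (at x within {0..1})" for h h' :: "real \<Rightarrow> real"
    using that unfolding differentiable_on_def
    by (metis real_differentiable_def)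
  have "f differentiable_on {0..1}" "f1 differentiable_on {0..1}"
    using f diff unfolding C2_derivs_def by blast+
  moreover from this have "deriv01 (Suc 0) f differentiable_on {0..1}"
    using C2_derivs_deriv01(1)[OF f] unfolding differentiable_on_def
    by (metis differentiable_transform_within zero_less_one)
  moreover have "continuous_on {0..1} (deriv01 2 f) \<longleftrightarrow> continuous_on {0..1} f2"
    using C2_derivs_deriv01(2)[OF f] by (intro continuous_on_cong) auto
  ultimately show "C2_01 f"
    using f by (auto simp: C2_01_def C2_derivs_def less_2_cases_iff deriv01_simps(1))
qed

lemma C2_derivs_add:
  assumes "C2_derivs f f1 f2" "C2_derivs g g1 g2"
  shows "C2_derivs (\<lambda>x. f x + g x) (\<lambda>x. f1 x + g1 x) (\<lambda>x. f2 x + g2 x)"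
  using assms unfolding C2_derivs_def by (auto intro!: DERIV_add continuous_on_add)

lemma C2_derivs_minus:
  assumes "C2_derivs f f1 f2"
  shows "C2_derivs (\<lambda>x. - f x) (\<lambda>x. - f1 x) (\<lambda>x. - f2 x)"
  using assms unfolding C2_derivs_def by (auto intro!: DERIV_minus continuous_on_minus)

lemma C2_derivs_sum:
  assumes "finite J" "\<And>j. j \<in> J \<Longrightarrow> C2_derivs (f j) (f1 j) (f2 j)"
  shows "C2_derivs (\<lambda>x. \<Sum>j\<in>J. f j x) (\<lambda>x. \<Sum>j\<in>J. f1 j x) (\<lambda>x. \<Sum>j\<in>J. f2 j x)"
  using assms unfolding C2_derivs_def
  by (auto intro!: DERIV_sum continuous_on_sum)

lemma C2_derivs_affine: "C2_derivs (\<lambda>x. a + b * x) (\<lambda>_. b) (\<lambda>_. 0)"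
  by (auto simp: C2_derivs_def intro!: derivative_eq_intros)

lemma C2_norm_le:
  assumes "C2_derivs f f1 f2"
    and "\<And>x. x \<in> {0..1} \<Longrightarrow> \<bar>f x\<bar> \<le> B"
    and "\<And>x. x \<in> {0..1} \<Longrightarrow> \<bar>f1 x\<bar> \<le> B"
    and "\<And>x. x \<in> {0..1} \<Longrightarrow> \<bar>f2 x\<bar> \<le> B"
  shows "C2_norm f \<le> B"
proof -
  have "(SUP x\<in>{0..1}. \<bar>deriv01 k f x\<bar>) \<le> B" if "k \<in> {0..2}" for k
  proof (rule cSUP_least)
    fix x :: real assume x: "x \<in> {0..1}"
    have "k = 0 \<or> k = Suc 0 \<or> k = 2" using that by auto
    then show "\<bar>deriv01 k f x\<bar> \<le> B"
      using assms(2-4)[OF x] C2_derivs_deriv01[OF assms(1) x] by (auto simp: deriv01_simps(1))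
  qed simp
  then show ?thesis by (simp add: C2_norm_def)
qed

section \<open>Interpolation by separated bumps\<close>

lemma DERIV_max_0_power:
  "((\<lambda>w::real. max 0 w ^ Suc (Suc n)) has_real_derivative real (Suc (Suc n)) * max 0 w ^ Suc n) (at w)"
proof (cases w "0::real" rule: linorder_cases)
  case less
  have "((\<lambda>_. 0) has_real_derivative 0) (at w)" by simp
  then have "((\<lambda>w::real. max 0 w ^ Suc (Suc n)) has_real_derivative 0) (at w)"
    using less by (elim has_field_derivative_transform_within_open[where S = "{..<0}"])
      (auto simp: max_def)
  then show ?thesis using less by (simp add: max_def)
next
  case greater
  have "((\<lambda>w. w ^ Suc (Suc n)) has_real_derivative real (Suc (Suc n)) * w ^ Suc n) (at w)"
    using DERIV_pow[of "Suc (Suc n)" w UNIV] by simp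
  then have "((\<lambda>w::real. max 0 w ^ Suc (Suc n)) has_real_derivative
      real (Suc (Suc n)) * w ^ Suc n) (at w)"
    using greater by (elim has_field_derivative_transform_within_open[where S = "{0<..}"])
      (auto simp: max_def)
  then show ?thesis using greater by (simp add: max_def)
next
  case equal
  have "((\<lambda>h::real. max 0 h ^ Suc n) \<longlongrightarrow> max 0 0 ^ Suc n) (at 0)"
    by (intro tendsto_intros)
  moreover have "max 0 h ^ Suc n = (max 0 (0 + h) ^ Suc (Suc n) - max 0 0 ^ Suc (Suc n)) / h"
    if "h \<noteq> 0" for h :: real
    using that by (simp add: max_def)
  ultimately have "((\<lambda>h::real. (max 0 (0 + h) ^ Suc (Suc n) - max 0 0 ^ Suc (Suc n)) / h) \<longlongrightarrow> 0) (at 0)"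
    by (auto intro: Lim_transform_eventually simp: eventually_at_filter)
  then show ?thesis using equal by (simp add: DERIV_def)
qed

text \<open>A bump of class \<open>C\<^sup>2\<close> supported in the interval from -1 to 1 with value 1 at the origin,
  and its first two derivatives.\<close>
definition bump :: "real \<Rightarrow> real" where
  "bump u = max 0 (1 - u\<^sup>2) ^ 3"

definition bump1 :: "real \<Rightarrow> real" where
  "bump1 u = - 6 * u * max 0 (1 - u\<^sup>2) ^ 2"

definition bump2 :: "real \<Rightarrow> real" where
  "bump2 u = 24 * u\<^sup>2 * max 0 (1 - u\<^sup>2) - 6 * max 0 (1 - u\<^sup>2) ^ 2"

lemma DERIV_bump: "(bump has_real_derivative bump1 u) (at u)"
proof -
  have "((\<lambda>u. 1 - u\<^sup>2) has_real_derivative - 2 * u) (at u)"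
    by (auto intro!: derivative_eq_intros)
  from DERIV_chain2[OF DERIV_max_0_power[of 1] this] show ?thesis
    by (simp add: bump_def[abs_def] bump1_def numeral_3_eq_3 numeral_2_eq_2 algebra_simps)
qed

lemma DERIV_bump1: "(bump1 has_real_derivative bump2 u) (at u)"
proof -
  have "((\<lambda>u. 1 - u\<^sup>2) has_real_derivative - 2 * u) (at u)"
    by (auto intro!: derivative_eq_intros)
  from DERIV_chain2[OF DERIV_max_0_power[of 0] this]
  have "((\<lambda>u. max 0 (1 - u\<^sup>2) ^ 2) has_real_derivative - 4 * u * max 0 (1 - u\<^sup>2)) (at u)"
    by (simp add: numeral_2_eq_2 algebra_simps)
  from DERIV_mult[OF DERIV_cmult_Id[of "-6"] this] show ?thesis
    by (simp add: bump1_def[abs_def] bump2_def power2_eq_square algebra_simps)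
qed

lemma continuous_on_bump2: "continuous_on A bump2"
  unfolding bump2_def[abs_def] by (intro continuous_intros)

lemma bump_0 [simp]: "bump 0 = 1"
  by (simp add: bump_def)

lemma bump_outside:
  assumes "1 \<le> \<bar>u\<bar>"
  shows "bump u = 0" "bump1 u = 0" "bump2 u = 0"
proof -
  have "1 \<le> u\<^sup>2" using assms by (metis abs_le_square_iff abs_one one_power2)
  then show "bump u = 0" "bump1 u = 0" "bump2 u = 0"
    by (simp_all add: bump_def bump1_def bump2_def max_def)
qed

lemma bump_bounds: "\<bar>bump u\<bar> \<le> 24" "\<bar>bump1 u\<bar> \<le> 24" "\<bar>bump2 u\<bar> \<le> 24"
proof -
  have "\<bar>bump u\<bar> \<le> 24 \<and> \<bar>bump1 u\<bar> \<le> 24 \<and> \<bar>bump2 u\<bar> \<le> 24"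
  proof (cases "1 \<le> \<bar>u\<bar>")
    case False
    define w where "w = 1 - u\<^sup>2"
    have u: "\<bar>u\<bar> \<le> 1" "0 \<le> u\<^sup>2" "u\<^sup>2 \<le> 1" using False by (auto simp: abs_square_le_1)
    have w: "0 \<le> w" "w \<le> 1" using u by (auto simp: w_def)
    have pw: "0 \<le> w ^ n" "w ^ n \<le> 1" for n using w by (auto simp: power_le_one)
    have uw: "0 \<le> u\<^sup>2 * w" "u\<^sup>2 * w \<le> 1" using u w by (auto intro: mult_le_one)
    have "\<bar>u * w\<^sup>2\<bar> \<le> 1"
      using u pw[of 2] by (auto simp: abs_mult intro: mult_le_one)
    moreover have "bump u = w ^ 3" "bump1 u = - 6 * (u * w\<^sup>2)" "bump2 u = 24 * (u\<^sup>2 * w) - 6 * w\<^sup>2"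
      using w by (simp_all add: bump_def bump1_def bump2_def w_def[symmetric])
    ultimately show ?thesis
      using pw[of 3] pw[of 2] uw by linarith
  qed (simp add: bump_outside)
  then show "\<bar>bump u\<bar> \<le> 24" "\<bar>bump1 u\<bar> \<le> 24" "\<bar>bump2 u\<bar> \<le> 24" by auto
qed

lemma C2_derivs_bump_scaled:
  assumes "0 < h"
  shows "C2_derivs (\<lambda>x. v * bump ((x - a) / h)) (\<lambda>x. v / h * bump1 ((x - a) / h))
           (\<lambda>x. v / h\<^sup>2 * bump2 ((x - a) / h))"
proof -
  have lin: "((\<lambda>x. (x - a) / h) has_real_derivative 1 / h) (at x within {0..1})" for x
    using assms by (auto intro!: derivative_eq_intros)
  have "((\<lambda>x. v * bump ((x - a) / h)) has_real_derivative v / h * bump1 ((x - a) / h))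
      (at x within {0..1})" for x
    using DERIV_cmult[OF DERIV_chain2[OF DERIV_bump lin], of v x] by (simp add: algebra_simps)
  moreover have "((\<lambda>x. v / h * bump1 ((x - a) / h)) has_real_derivative
      v / h\<^sup>2 * bump2 ((x - a) / h)) (at x within {0..1})" for x
    using DERIV_cmult[OF DERIV_chain2[OF DERIV_bump1 lin], of "v / h" x]
    by (simp add: algebra_simps power2_eq_square)
  moreover have "continuous_on {0..1} (\<lambda>x. v / h\<^sup>2 * bump2 ((x - a) / h))"
    using assms
    by (intro continuous_on_mult continuous_on_const continuous_on_compose2[OF continuous_on_bump2[of UNIV]])
       (auto intro!: continuous_intros)
  ultimately show ?thesis by (simp add: C2_derivs_def)
qed

lemma abs_sum_le_of_at_most_one:
  fixes f :: "'a \<Rightarrow> real"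
  assumes "finite J" "\<And>j. j \<in> J \<Longrightarrow> \<bar>f j\<bar> \<le> B" "0 \<le> B"
    and "\<And>i j. i \<in> J \<Longrightarrow> j \<in> J \<Longrightarrow> f i \<noteq> 0 \<Longrightarrow> f j \<noteq> 0 \<Longrightarrow> i = j"
  shows "\<bar>\<Sum>j\<in>J. f j\<bar> \<le> B"
proof (cases "\<exists>i\<in>J. f i \<noteq> 0")
  case True
  then obtain i where i: "i \<in> J" "f i \<noteq> 0" by blast
  have "(\<Sum>j\<in>J. f j) = (\<Sum>j\<in>{i}. f j)"
    using assms(1,4) i by (intro sum.mono_neutral_right) auto
  then show ?thesis using assms(2) i by simp
qed (use assms(3) in simp)

text \<open>Prescribing values of size at most \<open>V\<close> at points that are \<open>2 * h\<close> apart costs a \<open>C\<^sup>2\<close> norm of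
  order \<open>V / h\<^sup>2\<close> only, whatever the number of points, because the bumps have disjoint supports.\<close>
lemma bump_interpolation:
  fixes a v :: "'a \<Rightarrow> real"
  assumes J: "finite J" and h: "0 < h" "h \<le> 1" and V: "\<And>j. j \<in> J \<Longrightarrow> \<bar>v j\<bar> \<le> V" "0 \<le> V"
    and sep: "\<And>i j. i \<in> J \<Longrightarrow> j \<in> J \<Longrightarrow> i \<noteq> j \<Longrightarrow> 2 * h \<le> \<bar>a i - a j\<bar>"
  obtains f f1 f2 where "C2_derivs f f1 f2" "\<And>j. j \<in> J \<Longrightarrow> f (a j) = v j"
    "\<And>x. \<bar>f x\<bar> \<le> 24 * (V / h\<^sup>2)" "\<And>x. \<bar>f1 x\<bar> \<le> 24 * (V / h\<^sup>2)" "\<And>x. \<bar>f2 x\<bar> \<le> 24 * (V / h\<^sup>2)"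
proof -
  have unique: "i = j" if "i \<in> J" "j \<in> J" "\<bar>(x - a i) / h\<bar> < 1" "\<bar>(x - a j) / h\<bar> < 1" for i j x
  proof (rule ccontr)
    assume "i \<noteq> j"
    then have "2 * h \<le> \<bar>a i - a j\<bar>" using sep that by blast
    moreover have "\<bar>x - a i\<bar> < h" "\<bar>x - a j\<bar> < h" using that h by (auto simp: abs_divide)
    ultimately show False by linarith
  qed
  have bound: "\<bar>\<Sum>j\<in>J. w j * b ((x - a j) / h)\<bar> \<le> 24 * (V / h\<^sup>2)"
    if b: "\<And>u. \<bar>b u\<bar> \<le> 24" "\<And>u. 1 \<le> \<bar>u\<bar> \<Longrightarrow> b u = 0"
      and w: "\<And>j. j \<in> J \<Longrightarrow> \<bar>w j\<bar> \<le> V / h\<^sup>2" for w b x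
  proof (rule abs_sum_le_of_at_most_one[OF J])
    show "\<bar>w j * b ((x - a j) / h)\<bar> \<le> 24 * (V / h\<^sup>2)" if "j \<in> J" for j
    proof -
      have "\<bar>w j\<bar> * \<bar>b ((x - a j) / h)\<bar> \<le> (V / h\<^sup>2) * 24"
        using w[OF that] b V(2) by (intro mult_mono) auto
      then show ?thesis by (simp add: abs_mult mult.commute)
    qed
    show "i = j" if "i \<in> J" "j \<in> J" "w i * b ((x - a i) / h) \<noteq> 0" "w j * b ((x - a j) / h) \<noteq> 0" for i j
      using that b(2) by (intro unique[of i j x]) (auto simp: not_le[symmetric])
  qed (use V(2) in simp)
  have h2: "h\<^sup>2 \<le> h" "h\<^sup>2 \<le> 1"
    using h by (auto simp: power2_eq_square mult_le_one)
  have w: "\<bar>v j\<bar> \<le> V / h\<^sup>2" "\<bar>v j / h\<bar> \<le> V / h\<^sup>2" "\<bar>v j / h\<^sup>2\<bar> \<le> V / h\<^sup>2" if "j \<in> J" for j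
  proof -
    have "\<bar>v j\<bar> / 1 \<le> V / h\<^sup>2" "\<bar>v j\<bar> / h \<le> V / h\<^sup>2" "\<bar>v j\<bar> / h\<^sup>2 \<le> V / h\<^sup>2"
      using V(1)[OF that] V(2) h h2 by (intro frac_le; simp)+
    then show "\<bar>v j\<bar> \<le> V / h\<^sup>2" "\<bar>v j / h\<bar> \<le> V / h\<^sup>2" "\<bar>v j / h\<^sup>2\<bar> \<le> V / h\<^sup>2"
      using h by (auto simp: abs_divide)
  qed
  show thesis
  proof (rule that)
    show "C2_derivs (\<lambda>x. \<Sum>j\<in>J. v j * bump ((x - a j) / h))
        (\<lambda>x. \<Sum>j\<in>J. v j / h * bump1 ((x - a j) / h)) (\<lambda>x. \<Sum>j\<in>J. v j / h\<^sup>2 * bump2 ((x - a j) / h))"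
      using J h by (intro C2_derivs_sum C2_derivs_bump_scaled) auto
    show "\<bar>\<Sum>j\<in>J. v j * bump ((x - a j) / h)\<bar> \<le> 24 * (V / h\<^sup>2)" for x
      using w(1) bump_bounds bump_outside by (intro bound) auto
    show "\<bar>\<Sum>j\<in>J. v j / h * bump1 ((x - a j) / h)\<bar> \<le> 24 * (V / h\<^sup>2)" for x
      using w(2) bump_bounds bump_outside by (intro bound) auto
    show "\<bar>\<Sum>j\<in>J. v j / h\<^sup>2 * bump2 ((x - a j) / h)\<bar> \<le> 24 * (V / h\<^sup>2)" for x
      using w(3) bump_bounds bump_outside by (intro bound) auto
    show "(\<Sum>j\<in>J. v j * bump ((a i - a j) / h)) = v i" if "i \<in> J" for i
    proof -
      have "(\<Sum>j\<in>J. v j * bump ((a i - a j) / h)) = (\<Sum>j\<in>{i}. v j * bump ((a i - a j) / h))"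
        using that J h unique[of i _ "a i"] bump_outside(1)
        by (intro sum.mono_neutral_right) (fastforce simp: not_le[symmetric])+
      then show ?thesis by simp
    qed
  qed
qed

section \<open>Affine shifts for which many blocks contain a near-integer value\<close>

text \<open>A lower bound of Bonferroni type for the size of a union.\<close>
lemma card_UN_ge_pairwise:
  fixes A :: "nat \<Rightarrow> 'a set" and s e :: int
  assumes "\<And>i. i < n \<Longrightarrow> finite (A i)" "\<And>i. i < n \<Longrightarrow> int (card (A i)) = s"
    and "\<And>i j. i < j \<Longrightarrow> j < n \<Longrightarrow> int (card (A i \<inter> A j)) \<le> e" and "0 \<le> e"
  shows "2 * int n * s \<le> 2 * int (card (\<Union>i<n. A i)) + int n * int n * e"
  using assms
proof (induction n)
  case (Suc n)
  have fin: "finite (\<Union>i<n. A i)" "finite (A n)" using Suc.prems(1) by auto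
  have "card ((\<Union>i<n. A i) \<inter> A n) \<le> (\<Sum>i<n. card (A i \<inter> A n))"
    using card_UN_le[of "{..<n}" "\<lambda>i. A i \<inter> A n"] by (simp only: UN_simps finite_lessThan)
  then have "int (card ((\<Union>i<n. A i) \<inter> A n)) \<le> (\<Sum>i<n. int (card (A i \<inter> A n)))"
    by (simp only: of_nat_sum[symmetric] of_nat_le_iff)
  also have "\<dots> \<le> (\<Sum>i<n. e)"
    using Suc.prems(3) by (intro sum_mono) auto
  finally have meet: "int (card ((\<Union>i<n. A i) \<inter> A n)) \<le> int n * e" by simp
  have "int (card (\<Union>i<n. A i)) + int (card (A n))
      = int (card (\<Union>i<Suc n. A i)) + int (card ((\<Union>i<n. A i) \<inter> A n))"
    using card_Un_Int[OF fin] by (simp add: lessThan_Suc Un_commute)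
  moreover have "2 * int n * s \<le> 2 * int (card (\<Union>i<n. A i)) + int n * int n * e"
    using Suc.prems by (intro Suc.IH) auto
  moreover have "int (card (A n)) = s" using Suc.prems(2) by simp
  moreover have "int (Suc n) * int (Suc n) * e = int n * int n * e + 2 * (int n * e) + e"
    "2 * int (Suc n) * s = 2 * int n * s + 2 * s"
    by (simp_all add: algebra_simps)
  ultimately show ?case using meet Suc.prems(4) by linarith
qed simp

text \<open>The pairs of residues \<open>(l, k)\<close> modulo \<open>p\<close>, regarded as lines \<open>l + k * b\<close>, for which
  \<open>u b + l + k * b\<close> reduces modulo \<open>p\<close> to one of the residues below \<open>M\<close>.\<close>
definition hitting_lines :: "int \<Rightarrow> int \<Rightarrow> (int \<Rightarrow> int) \<Rightarrow> int \<Rightarrow> (int \<times> int) set" where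
  "hitting_lines p M u b = {(l, k) \<in> {0..<p} \<times> {0..<p}. (u b + l + k * b) mod p < M}"

lemma finite_hitting_lines [simp]: "finite (hitting_lines p M u b)"
  by (rule finite_subset[of _ "{0..<p} \<times> {0..<p}"]) (auto simp: hitting_lines_def)

lemma card_hitting_lines:
  assumes "0 \<le> M" "M \<le> p" "0 < p"
  shows "int (card (hitting_lines p M u b)) = p * M"
proof -
  have fwd: "(u b + (r - u b - k * b) mod p + k * b) mod p = r mod p" for r k
    using mod_add_right_eq[of "u b + k * b" "r - u b - k * b" p] by (simp add: algebra_simps)
  have bwd: "((u b + l + k * b) mod p - u b - k * b) mod p = l mod p" for l k
    using mod_diff_left_eq[of "u b + l + k * b" p "u b + k * b"] by (simp add: algebra_simps)
  have "bij_betw (\<lambda>(l, k). ((u b + l + k * b) mod p, k)) (hitting_lines p M u b) ({0..<M} \<times> {0..<p})"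
    by (rule bij_betw_byWitness[where f' = "\<lambda>(r, k). ((r - u b - k * b) mod p, k)"])
       (use assms fwd bwd in \<open>auto simp: hitting_lines_def\<close>)
  then have "card (hitting_lines p M u b) = card ({0..<M} \<times> {0..<p})"
    by (rule bij_betw_same_card)
  then show ?thesis using assms by (simp add: card_cartesian_product)
qed

text \<open>A line modulo a prime is determined by its values at two distinct residues.\<close>
lemma card_hitting_lines_Int:
  assumes "prime p" "\<not> p dvd b - b'" "0 \<le> M"
  shows "int (card (hitting_lines p M u b \<inter> hitting_lines p M u b')) \<le> M * M"
proof -
  let ?f = "\<lambda>(l, k). ((u b + l + k * b) mod p, (u b' + l + k * b') mod p)"
  have p: "0 < p" using assms(1) by (simp add: prime_gt_0_int)
  have "inj_on ?f (hitting_lines p M u b \<inter> hitting_lines p M u b')"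
  proof (rule inj_onI, clarsimp simp: hitting_lines_def)
    fix l k l' k'
    assume l: "0 \<le> l" "l < p" "0 \<le> l'" "l' < p" and k: "0 \<le> k" "k < p" "0 \<le> k'" "k' < p"
      and eq: "(u b + l + k * b) mod p = (u b + l' + k' * b) mod p"
        "(u b' + l + k * b') mod p = (u b' + l' + k' * b') mod p"
    have d: "p dvd (l - l') + (k - k') * b" "p dvd (l - l') + (k - k') * b'"
      using eq by (simp_all add: mod_eq_dvd_iff algebra_simps)
    then have "p dvd (k - k') * (b - b')"
      using dvd_diff[OF d] by (simp add: algebra_simps)
    then have dk: "p dvd k - k'" using assms(1,2) by (simp add: prime_dvd_mult_iff)
    then have "k mod p = k' mod p" by (simp add: mod_eq_dvd_iff)
    then have kk: "k = k'" using k by simp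
    then have "l mod p = l' mod p" using d(1) by (simp add: mod_eq_dvd_iff)
    then show "l = l' \<and> k = k'" using l kk by simp
  qed
  moreover have "?f ` (hitting_lines p M u b \<inter> hitting_lines p M u b') \<subseteq> {0..<M} \<times> {0..<M}"
    using p by (auto simp: hitting_lines_def)
  ultimately have "card (hitting_lines p M u b \<inter> hitting_lines p M u b') \<le> card ({0..<M} \<times> {0..<M})"
    by (intro card_inj_on_le) auto
  then show ?thesis using assms(3)
    by (simp add: card_cartesian_product) (metis (no_types, lifting) int_nat_eq of_nat_le_iff of_nat_mult)
qed

lemma pigeonhole_quarter:
  fixes U :: "nat \<Rightarrow> 'a set"
  assumes "finite \<Omega>" "\<Omega> \<noteq> {}" "\<And>j. j < W \<Longrightarrow> U j \<subseteq> \<Omega> \<and> card \<Omega> \<le> 4 * card (U j)"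
  shows "\<exists>\<omega>\<in>\<Omega>. W \<le> 4 * card {j\<in>{..<W}. \<omega> \<in> U j}"
proof (rule ccontr)
  assume "\<not> ?thesis"
  then have "\<And>\<omega>. \<omega> \<in> \<Omega> \<Longrightarrow> 4 * card {j\<in>{..<W}. \<omega> \<in> U j} < W" by (auto simp: not_le)
  then have "(\<Sum>\<omega>\<in>\<Omega>. 4 * card {j\<in>{..<W}. \<omega> \<in> U j}) < (\<Sum>\<omega>\<in>\<Omega>. W)"
    using assms by (intro sum_strict_mono) auto
  moreover have "(\<Sum>\<omega>\<in>\<Omega>. card {j\<in>{..<W}. \<omega> \<in> U j}) = (\<Sum>j<W. card {\<omega>\<in>\<Omega>. \<omega> \<in> U j})"
    using assms(1) by (intro sum_multicount_gen) auto
  moreover have "(\<Sum>j<W. card {\<omega>\<in>\<Omega>. \<omega> \<in> U j}) = (\<Sum>j<W. card (U j))"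
    using assms(3) by (intro sum.cong refl arg_cong[where f = card]) auto
  moreover have "(\<Sum>j<W. card \<Omega>) \<le> (\<Sum>j<W. 4 * card (U j))"
    using assms(3) by (intro sum_mono) auto
  ultimately show False by (simp add: sum_distrib_left[symmetric] sum_distrib_right[symmetric] mult.commute)
qed

text \<open>For arbitrary real data \<open>F\<close>, some affine shift brings \<open>F\<close> within \<open>1 / H\<close> above an integer somewhere
  in at least a quarter of the blocks of \<open>H\<close> consecutive integers that start at \<open>2 * j * H\<close>. The
  shift is chosen among those with coefficients \<open>l / p\<close> and \<open>k / p\<close> for a prime \<open>p\<close> greater than
  \<open>H\<close>: for these the values at two places of a block are independent, each is favourable with
  probability between \<open>1 / (2 * H)\<close> and \<open>1 / H\<close>, and hence each block is hit with probability at
  least a quarter.\<close>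
lemma exists_affine_shift_near_integers:
  fixes F :: "int \<Rightarrow> real" and H W :: nat
  assumes H: "1 \<le> H"
  obtains \<theta> t :: real and J :: "nat set" and i :: "nat \<Rightarrow> nat" and q :: "nat \<Rightarrow> int"
  where "0 \<le> \<theta>" "\<theta> \<le> 1" "0 \<le> t" "t \<le> 1" "J \<subseteq> {..<W}" "W \<le> 4 * card J"
    "\<And>j. j \<in> J \<Longrightarrow> i j < H"
    "\<And>j. j \<in> J \<Longrightarrow> 0 \<le> F (2 * j * H + i j) + \<theta> + t * (2 * j * H + i j) - q j"
    "\<And>j. j \<in> J \<Longrightarrow> F (2 * j * H + i j) + \<theta> + t * (2 * j * H + i j) - q j \<le> 1 / H"
proof -
  obtain p0 :: nat where p0: "prime p0" "H < p0" using bigger_prime by blast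
  define p where "p = int p0"
  have p: "prime p" "int H < p" "0 < p" using p0 H by (auto simp: p_def)
  define M where "M = p div int H"
  have "int H * M + p mod int H = p" unfolding M_def by (rule mult_div_mod_eq)
  moreover have "0 \<le> p mod int H" "p mod int H < int H" using H by simp_all
  ultimately have HM: "int H * M \<le> p" and "p < int H * M + int H" by linarith+
  have M1: "1 \<le> M" using p H by (simp add: M_def pos_imp_zdiv_pos_iff int_one_le_iff_zero_less)
  have "int H \<le> int H * M" using mult_left_mono[OF M1, of "int H"] by simp
  with \<open>p < int H * M + int H\<close> have HM2: "p \<le> 2 * (int H * M)" by linarith
  have "1 * M \<le> int H * M" using H M1 by (intro mult_right_mono) auto
  then have Mp: "M \<le> p" using HM by simp
  \<comment> \<open>Rounding down the multiples by \<open>p\<close> costs less than one residue, so that one of the first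
    \<open>M\<close> residues modulo \<open>p\<close> corresponds to a distance less than \<open>M / p\<close> from an integer.\<close>
  define u where "u = (\<lambda>b. \<lfloor>real_of_int p * F b\<rfloor>)"
  define b where "b = (\<lambda>j i. int (2 * j * H + i))"
  define U where "U = (\<lambda>j. \<Union>i<H. hitting_lines p M u (b j i))"
  let ?\<Omega> = "{0..<p} \<times> {0..<p}"
  have U: "U j \<subseteq> ?\<Omega> \<and> card ?\<Omega> \<le> 4 * card (U j)" for j
  proof
    show "U j \<subseteq> ?\<Omega>" by (auto simp: U_def hitting_lines_def)
    \<comment> \<open>The pairs overlap in at most \<open>(H * M)\<^sup>2 / 2\<close> lines, which is at most half of the total
      \<open>H * M * p\<close> because \<open>H * M \<le> p\<close>.\<close>
    have "2 * int H * (p * M) \<le> 2 * int (card (U j)) + int H * int H * (M * M)"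
      unfolding U_def
    proof (rule card_UN_ge_pairwise)
      fix i i' assume i: "i < i'" "i' < H"
      have "\<not> p dvd b j i' - b j i"
        using i p by (intro zdvd_not_zless) (auto simp: b_def)
      then have "\<not> p dvd b j i - b j i'" by (metis dvd_minus_iff minus_diff_eq)
      then show "int (card (hitting_lines p M u (b j i) \<inter> hitting_lines p M u (b j i'))) \<le> M * M"
        using p M1 by (intro card_hitting_lines_Int) auto
    qed (use M1 Mp p in \<open>simp_all add: card_hitting_lines\<close>)
    moreover have "(int H * M) * (int H * M) \<le> p * (int H * M)"
      using HM M1 by (intro mult_right_mono) auto
    moreover have "p * p \<le> p * (2 * (int H * M))"
      using HM2 p by (intro mult_left_mono) auto
    ultimately have "p * p \<le> 4 * int (card (U j))" by (simp add: algebra_simps)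
    moreover have "int (card ?\<Omega>) = p * p" using p by (simp add: card_cartesian_product)
    ultimately show "card ?\<Omega> \<le> 4 * card (U j)" by linarith
  qed
  have "\<exists>\<omega>\<in>?\<Omega>. W \<le> 4 * card {j\<in>{..<W}. \<omega> \<in> U j}"
  proof (rule pigeonhole_quarter)
    show "?\<Omega> \<noteq> {}" using p(3) by auto
  qed (use U in simp_all)
  then obtain l k where lk: "(l, k) \<in> ?\<Omega>" "W \<le> 4 * card {j\<in>{..<W}. (l, k) \<in> U j}"
    by (metis surj_pair)
  define J where "J = {j\<in>{..<W}. (l, k) \<in> U j}"
  define i where "i = (\<lambda>j. SOME i. i < H \<and> (l, k) \<in> hitting_lines p M u (b j i))"
  have i: "i j < H" "(l, k) \<in> hitting_lines p M u (b j (i j))" if "j \<in> J" for j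
  proof -
    have "\<exists>i. i < H \<and> (l, k) \<in> hitting_lines p M u (b j i)" using that by (auto simp: J_def U_def)
    from someI_ex[OF this] show "i j < H" "(l, k) \<in> hitting_lines p M u (b j (i j))"
      by (auto simp: i_def)
  qed
  define q where "q = (\<lambda>j. (u (b j (i j)) + l + k * b j (i j)) div p)"
  have near: "0 \<le> F (b j (i j)) + l / p + k / p * b j (i j) - q j \<and>
      F (b j (i j)) + l / p + k / p * b j (i j) - q j \<le> 1 / H" if "j \<in> J" for j
  proof -
    define B where "B = b j (i j)"
    define r where "r = (u B + l + k * B) mod p"
    have r: "0 \<le> r" "r + 1 \<le> M"
      using i(2)[OF that] p by (auto simp: hitting_lines_def r_def B_def)
    have "u B + l + k * B = p * q j + r" by (simp add: q_def r_def B_def)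
    then have "of_int (u B) + of_int l + of_int k * of_int B = (of_int p * of_int (q j) + of_int r :: real)"
      by (metis of_int_add of_int_mult)
    moreover have "of_int (u B) \<le> of_int p * F B" "of_int p * F B \<le> of_int (u B) + 1"
      unfolding u_def by (rule of_int_floor_le, rule less_imp_le[OF real_of_int_floor_add_one_gt])
    moreover have "0 \<le> real_of_int r" "real_of_int r + 1 \<le> of_int M" using r by linarith+
    moreover have "of_int p * F B + of_int l + of_int k * of_int B - of_int p * of_int (q j)
        = of_int p * (F B + l / p + k / p * B - q j)"
      using p by (simp add: field_simps)
    ultimately have "0 \<le> of_int p * (F B + l / p + k / p * B - q j)"
      "of_int p * (F B + l / p + k / p * B - q j) \<le> of_int M" by linarith+
    moreover have "real_of_int M \<le> of_int p * (1 / H)"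
    proof -
      have "real_of_int (int H * M) \<le> of_int p" using HM by (simp only: of_int_le_iff)
      then show ?thesis using H by (simp add: field_simps)
    qed
    ultimately have "0 \<le> of_int p * (F B + l / p + k / p * B - q j)"
      "of_int p * (F B + l / p + k / p * B - q j) \<le> of_int p * (1 / H)" by linarith+
    then show ?thesis using p unfolding B_def[symmetric]
      by (simp add: zero_le_mult_iff mult_le_cancel_left_pos del: times_divide_eq_right)
  qed
  show thesis
  proof (rule that[of "l / p" "k / p" J i q])
    show "0 \<le> real_of_int l / p" "real_of_int l / p \<le> 1" "0 \<le> real_of_int k / p" "real_of_int k / p \<le> 1"
      using lk p by auto
    show "J \<subseteq> {..<W}" "W \<le> 4 * card J" using lk by (auto simp: J_def)
    show "i j < H" if "j \<in> J" for j using i that by blast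
  qed (use near in \<open>auto simp: b_def\<close>)
qed

section \<open>Lattice points on the perturbed graph\<close>

lemma finite_graph01_Int_scaled_lattice:
  assumes "0 < Q"
  shows "finite (graph01 f \<inter> scaled_lattice Q)"
proof (rule finite_subset)
  show "graph01 f \<inter> scaled_lattice Q \<subseteq> (\<lambda>a. vector [of_int a / Q, f (of_int a / Q)]) ` {0..\<lfloor>Q\<rfloor>}"
  proof
    fix z assume z: "z \<in> graph01 f \<inter> scaled_lattice Q"
    then obtain \<xi> where \<xi>: "z = vector [\<xi>, f \<xi>]" "0 \<le> \<xi>" "\<xi> \<le> 1" by (auto simp: graph01_def)
    obtain y where y: "z = inverse Q *\<^sub>R y" "\<forall>i. y $ i \<in> \<int>"
      using z by (auto simp: scaled_lattice_def int_lattice_def)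
    obtain a where a: "y $ 1 = of_int a" using y(2) by (metis Ints_cases)
    have "z $ 1 = \<xi>" using \<xi>(1) by simp
    then have "\<xi> = of_int a / Q" using y(1) a by (simp add: divide_inverse mult.commute)
    moreover have "0 \<le> a" "a \<le> \<lfloor>Q\<rfloor>"
    proof -
      have a_eq: "real_of_int a = Q * \<xi>" using \<open>\<xi> = of_int a / Q\<close> assms by simp
      have "0 \<le> Q * \<xi>" "Q * \<xi> \<le> Q * 1" using \<xi> assms by (auto intro: mult_left_mono)
      then show "0 \<le> a" "a \<le> \<lfloor>Q\<rfloor>" unfolding a_eq[symmetric] by (auto simp: le_floor_iff)
    qed
    ultimately show "z \<in> (\<lambda>a. vector [of_int a / Q, f (of_int a / Q)]) ` {0..\<lfloor>Q\<rfloor>}"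
      using \<xi>(1) by auto
  qed
qed simp

lemma vector_mem_scaled_lattice:
  assumes "0 < Q" "x * Q \<in> \<int>" "y * Q \<in> \<int>"
  shows "vector [x, y] \<in> scaled_lattice Q"
  unfolding scaled_lattice_def
proof (rule image_eqI)
  show "vector [x, y] = inverse Q *\<^sub>R (vector [x * Q, y * Q] :: real^2)"
    using assms(1) by (simp add: vec_eq_iff forall_2)
  show "vector [x * Q, y * Q] \<in> int_lattice"
    using assms by (simp add: int_lattice_def forall_2)
qed

text \<open>The perturbation with explicit parameters: \<open>W\<close> blocks of \<open>H\<close> consecutive multiples of \<open>m / Q\<close>,
  separated by gaps of the same length, fit into the unit interval.\<close>
lemma exists_perturbation_with_lattice_points:
  fixes Q :: real and m H W :: nat
  assumes \<phi>: "C2_01 \<phi>" and pos: "1 \<le> Q" "1 \<le> m" "1 \<le> H" "1 \<le> W"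
    and fit: "2 * real m * H * W \<le> Q"
  shows "\<exists>f. C2_01 f \<and> C2_norm (\<lambda>x. \<phi> x - f x) \<le> 1 / Q + 1 / m + 96 * Q / (real m ^ 2 * real H ^ 3) \<and>
    W \<le> 4 * card (graph01 f \<inter> scaled_lattice Q)"
proof -
  define F where "F = (\<lambda>b::int. Q * \<phi> (m * b / Q))"
  obtain \<theta> t :: real and J i and q :: "nat \<Rightarrow> int" where \<theta>: "0 \<le> \<theta>" "\<theta> \<le> 1" and t: "0 \<le> t" "t \<le> 1"
    and J: "J \<subseteq> {..<W}" "W \<le> 4 * card J" and i: "\<And>j. j \<in> J \<Longrightarrow> i j < H"
    and near: "\<And>j. j \<in> J \<Longrightarrow> 0 \<le> F (2 * j * H + i j) + \<theta> + t * (2 * j * H + i j) - q j"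
      "\<And>j. j \<in> J \<Longrightarrow> F (2 * j * H + i j) + \<theta> + t * (2 * j * H + i j) - q j \<le> 1 / H"
    by (rule exists_affine_shift_near_integers[OF pos(3), where F = F and W = W]) blast
  define b where "b = (\<lambda>j. 2 * j * H + i j)"
  define a where "a = (\<lambda>j. m * b j / Q)"
  define e where "e = (\<lambda>j. Q * \<phi> (a j) + \<theta> + t * b j - q j)"
  have e: "0 \<le> e j" "e j \<le> 1 / H" if "j \<in> J" for j
    using near[OF that] by (auto simp: e_def F_def a_def b_def)
  \<comment> \<open>Half of a lower bound for the distance between points of different blocks.\<close>
  define h where "h = m * H / (2 * Q)"
  have fJ: "finite J" using J(1) finite_subset by blast
  have mH: "1 \<le> real m * H" using pos by (metis mult_le_mono nat_mult_1 of_nat_1 of_nat_le_iff of_nat_mult)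
  have "real m * H * 1 \<le> real m * H * W" using pos by (intro mult_left_mono) auto
  then have mHQ: "real m * H \<le> Q" using fit mH by linarith
  have h: "0 < h" "h \<le> 1" using mH mHQ pos by (auto simp: h_def field_simps)
  have gap: "H \<le> b j' - b j \<and> b j \<le> b j'" if "j \<in> J" "j < j'" for j j'
  proof -
    have "2 * (j + 1) * H \<le> 2 * j' * H" using that by (intro mult_right_mono) auto
    then show ?thesis using i[OF that(1)] by (simp add: b_def algebra_simps)
  qed
  have sep1: "2 * h \<le> \<bar>a j - a j'\<bar>" if "j \<in> J" "j < j'" for j j'
  proof -
    have "real H \<le> real (b j') - real (b j)" using gap[OF that] by linarith
    then have "real m * real H \<le> m * (real (b j') - real (b j))" by (intro mult_left_mono) auto
    then have "real m * real H / Q \<le> m * (real (b j') - real (b j)) / Q"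
      using pos by (intro divide_right_mono) auto
    moreover have "a j' - a j = m * (real (b j') - real (b j)) / Q"
      by (simp add: a_def algebra_simps diff_divide_distrib)
    moreover have "2 * h = real m * real H / Q" by (simp add: h_def)
    ultimately have "2 * h \<le> a j' - a j" by simp
    then show ?thesis by linarith
  qed
  have sep: "2 * h \<le> \<bar>a j - a j'\<bar>" if "j \<in> J" "j' \<in> J" "j \<noteq> j'" for j j'
    using that sep1[of j j'] sep1[of j' j] by (cases "j < j'") (auto simp: abs_minus_commute)
  define V where "V = 1 / (H * Q)"
  have V: "\<bar>- e j / Q\<bar> \<le> V" if "j \<in> J" for j
    using e[OF that] pos by (simp add: V_def abs_if field_simps)
  have V0: "0 \<le> V" using pos by (simp add: V_def)
  obtain \<psi> \<psi>1 \<psi>2 where \<psi>: "C2_derivs \<psi> \<psi>1 \<psi>2" "\<And>j. j \<in> J \<Longrightarrow> \<psi> (a j) = - e j / Q"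
    "\<And>x. \<bar>\<psi> x\<bar> \<le> 24 * (V / h\<^sup>2)" "\<And>x. \<bar>\<psi>1 x\<bar> \<le> 24 * (V / h\<^sup>2)" "\<And>x. \<bar>\<psi>2 x\<bar> \<le> 24 * (V / h\<^sup>2)"
    by (rule bump_interpolation[where v = "\<lambda>j. - e j / Q", OF fJ h V V0 sep]) blast+
  have size: "24 * (V / h\<^sup>2) = 96 * Q / (real m ^ 2 * real H ^ 3)"
    using pos by (simp add: V_def h_def field_simps power2_eq_square power3_eq_cube)
  define P where "P = (\<lambda>x. (\<theta> / Q + t / m * x) + \<psi> x)"
  have P: "C2_derivs P (\<lambda>x. t / m + \<psi>1 x) (\<lambda>x. 0 + \<psi>2 x)"
    unfolding P_def by (intro C2_derivs_add C2_derivs_affine \<psi>)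
  define f where "f = (\<lambda>x. \<phi> x + P x)"
  have f: "C2_01 f" using \<phi> P unfolding C2_01_iff_C2_derivs f_def by (blast intro: C2_derivs_add)
  have c: "0 \<le> \<theta> / Q" "\<theta> / Q \<le> 1 / Q" "0 \<le> t / m" "t / m \<le> 1 / m"
    using \<theta> t pos by (auto simp: divide_right_mono)
  \<comment> \<open>The sign matches \<open>\<phi> - f\<close>.\<close>
  have "C2_norm (\<lambda>x. - P x) \<le> 1 / Q + 1 / m + 24 * (V / h\<^sup>2)"
  proof (rule C2_norm_le[OF C2_derivs_minus[OF P]])
    fix x :: real assume x: "x \<in> {0..1}"
    have "0 \<le> t / m * x" "t / m * x \<le> t / m * 1"
      using x c mult_left_mono[of x 1 "t / m"] mult_nonneg_nonneg[of "t / m" x] by simp_all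
    then show "\<bar>- P x\<bar> \<le> 1 / Q + 1 / m + 24 * (V / h\<^sup>2)"
      using c \<psi>(3)[of x] unfolding P_def by linarith
    show "\<bar>- (t / m + \<psi>1 x)\<bar> \<le> 1 / Q + 1 / m + 24 * (V / h\<^sup>2)" using c \<psi>(4)[of x] by linarith
    show "\<bar>- (0 + \<psi>2 x)\<bar> \<le> 1 / Q + 1 / m + 24 * (V / h\<^sup>2)" using c \<psi>(5)[of x] by linarith
  qed
  moreover have "(\<lambda>x. \<phi> x - f x) = (\<lambda>x. - P x)" by (simp add: f_def)
  ultimately have norm: "C2_norm (\<lambda>x. \<phi> x - f x) \<le> 1 / Q + 1 / m + 96 * Q / (real m ^ 2 * real H ^ 3)"
    by (simp only: size)
  have "inj_on (\<lambda>j. vector [a j, f (a j)] :: real^2) J"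
  proof (rule inj_onI)
    fix j j' assume jj: "j \<in> J" "j' \<in> J" "(vector [a j, f (a j)] :: real^2) = vector [a j', f (a j')]"
    then have "a j = a j'" by (metis vector_2(1))
    then show "j = j'" using sep jj h by fastforce
  qed
  moreover have "(\<lambda>j. vector [a j, f (a j)]) ` J \<subseteq> graph01 f \<inter> scaled_lattice Q"
  proof (intro image_subsetI IntI)
    fix j assume j: "j \<in> J"
    have "b j < 2 * (j + 1) * H" using i[OF j] by (simp add: b_def algebra_simps)
    also have "\<dots> \<le> 2 * W * H" using j J(1) by (intro mult_right_mono) auto
    finally have "real (b j) \<le> 2 * W * H" by (metis less_imp_le of_nat_le_iff)
    then have "m * real (b j) \<le> m * real (2 * W * H)" by (intro mult_left_mono) auto
    then have "m * real (b j) \<le> Q" using fit by (simp add: algebra_simps)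
    then have "a j \<in> {0..1}" using pos by (simp add: a_def field_simps)
    then show "vector [a j, f (a j)] \<in> graph01 f" by (auto simp: graph01_def)
    have "a j * Q = of_nat (m * b j)" using pos by (simp add: a_def)
    moreover have "f (a j) * Q = of_int (q j)"
    proof -
      have "f (a j) * Q = \<phi> (a j) * Q + \<theta> / Q * Q + t / m * a j * Q + \<psi> (a j) * Q"
        by (simp add: f_def P_def distrib_right del: times_divide_eq_left times_divide_eq_right)
      moreover have "t / m * a j * Q = t * b j" "\<theta> / Q * Q = \<theta>" using pos by (simp_all add: a_def)
      moreover have "\<psi> (a j) * Q = - e j" using \<psi>(2)[OF j] pos by simp
      ultimately show ?thesis by (simp add: e_def mult.commute)
    qed
    ultimately show "vector [a j, f (a j)] \<in> scaled_lattice Q"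
      using pos by (intro vector_mem_scaled_lattice) (simp_all del: of_nat_mult)
  qed
  ultimately have "card J \<le> card (graph01 f \<inter> scaled_lattice Q)"
    using pos by (intro card_inj_on_le finite_graph01_Int_scaled_lattice) auto
  then show ?thesis using f norm J(2) by (intro exI[of _ f]) auto
qed

theorem theorem5p5:
  shows "\<exists>(C::real) (\<epsilon>\<^sub>0::real) (Q\<^sub>0::real \<Rightarrow> real) (c::real \<Rightarrow> real \<Rightarrow> real).
    C > 0 \<and> \<epsilon>\<^sub>0 > 0 \<and>
    (\<forall>\<epsilon>. 0 < \<epsilon> \<and> \<epsilon> < \<epsilon>\<^sub>0 \<longrightarrow> Q\<^sub>0 \<epsilon> > 0) \<and>
    (\<forall>\<delta> \<epsilon>. \<delta> > 0 \<and> 0 < \<epsilon> \<and> \<epsilon> < \<epsilon>\<^sub>0 \<longrightarrow> c \<delta> \<epsilon> > 0) \<and>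
    (\<forall>(\<phi>::real \<Rightarrow> real) (\<delta>::real) (\<epsilon>::real) (Q::real).
       C2_01 \<phi> \<and> \<delta> > 0 \<and> 0 < \<epsilon> \<and> \<epsilon> < \<epsilon>\<^sub>0 \<and> Q \<ge> Q\<^sub>0 \<epsilon> \<longrightarrow>
       (\<exists>(g::real^2^2) (\<phi>\<^sub>g::real \<Rightarrow> real).
          g \<in> SL2 \<and>
          (MAX i. MAX j. \<bar>g $ i $ j - (if i = j then 1 else 0)\<bar>) \<le> C * \<delta> \<and>
          C2_01 \<phi>\<^sub>g \<and>
          C2_norm (\<lambda>x. \<phi> x - \<phi>\<^sub>g x) \<le> C * \<epsilon> \<and>
          real (card (((*v) g ` graph01 \<phi>\<^sub>g) \<inter> scaled_lattice Q)) \<ge> c \<delta> \<epsilon> * Q powr (2 / 3)))"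
\<comment> \<open>The threshold makes \<open>Q powr (1 / 3)\<close> at least \<open>8 / \<epsilon>\<close>, so that there is at least one
  block and rounding the number of blocks to an integer loses at most a factor 2.\<close>
proof (rule exI[of _ 100], rule exI[of _ 1], rule exI[of _ "\<lambda>\<epsilon>. (8 / \<epsilon>) ^ 3"],
    rule exI[of _ "\<lambda>\<delta> \<epsilon>. \<epsilon> / 64"], intro conjI allI impI)
  fix \<phi> :: "real \<Rightarrow> real" and \<delta> \<epsilon> Q :: real
  assume "C2_01 \<phi> \<and> \<delta> > 0 \<and> 0 < \<epsilon> \<and> \<epsilon> < 1 \<and> Q \<ge> (8 / \<epsilon>) ^ 3"
  then have \<phi>: "C2_01 \<phi>" and \<delta>: "\<delta> > 0" and \<epsilon>: "0 < \<epsilon>" "\<epsilon> < 1" and Q: "(8 / \<epsilon>) ^ 3 \<le> Q" by auto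
  define t where "t = root 3 Q"
  have t3: "t ^ 3 = Q" by (simp add: t_def odd_real_root_pow)
  have "0 \<le> (8 / \<epsilon>) ^ 3" using \<epsilon> by simp
  then have t0: "0 \<le> t" using Q unfolding t_def by (intro real_root_ge_zero) linarith
  have e8: "8 / \<epsilon> \<le> t"
    using power_le_imp_le_base[of "8 / \<epsilon>" 2 t] Q \<epsilon> t3 t0 by (simp add: eval_nat_numeral)
  have "8 \<le> 8 / \<epsilon>" using \<epsilon> by (simp add: field_simps)
  then have t: "8 \<le> t" using e8 by linarith
  define m where "m = nat \<lceil>1 / \<epsilon>\<rceil>"
  define H where "H = nat \<lceil>t\<rceil>"
  define R where "R = Q / (2 * m * H)"
  define W where "W = nat \<lfloor>R\<rfloor>"
  have "1 \<le> 1 / \<epsilon>" using \<epsilon> by (simp add: field_simps)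
  then have m: "1 / \<epsilon> \<le> m" "m \<le> 2 / \<epsilon>" "1 \<le> m" unfolding m_def by linarith+
  have H: "t \<le> H" "H \<le> 2 * t" "1 \<le> H" using t unfolding H_def by linarith+
  have mH: "2 * real m * H \<le> 8 * t / \<epsilon>"
  proof -
    have "real m * H \<le> (2 / \<epsilon>) * (2 * t)" using m H \<epsilon> by (intro mult_mono) auto
    then show ?thesis by simp
  qed
  have "\<epsilon> * t\<^sup>2 / 8 = Q / (8 * t / \<epsilon>)"
    using t \<epsilon> by (simp add: t3[symmetric] field_simps power2_eq_square power3_eq_cube)
  also have "\<dots> \<le> Q / (2 * m * H)"
    using mH m H t t3 \<epsilon> by (intro divide_left_mono) auto
  finally have big: "\<epsilon> * t\<^sup>2 / 8 \<le> R" by (simp only: R_def)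
  have "8 \<le> \<epsilon> * t" using e8 \<epsilon> by (simp add: field_simps)
  then have "8 * 1 \<le> (\<epsilon> * t) * t" using t by (intro mult_mono) auto
  then have "1 \<le> \<epsilon> * t\<^sup>2 / 8" by (simp add: power2_eq_square)
  moreover from this have "real W \<le> R" "R < real W + 1"
    using big unfolding W_def by linarith+
  moreover from calculation have "1 \<le> W" using big by linarith
  moreover from this have "1 \<le> real W" by simp
  ultimately have W: "1 \<le> W" "\<epsilon> * t\<^sup>2 / 16 \<le> W" "W \<le> R"
    using big by linarith+
  have fit: "2 * real m * H * W \<le> Q" using W(3) m H by (simp add: R_def field_simps)
  have tQ: "t \<le> Q"
    using t t3 power_increasing[of 1 3 t] by simp
  obtain f where f: "C2_01 f" "C2_norm (\<lambda>x. \<phi> x - f x) \<le> 1 / Q + 1 / m + 96 * Q / (real m ^ 2 * real H ^ 3)"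
    "W \<le> 4 * card (graph01 f \<inter> scaled_lattice Q)"
    using exists_perturbation_with_lattice_points[OF \<phi> _ m(3) H(3) W(1) fit] tQ t by auto
  have "1 / m \<le> \<epsilon>" using m \<epsilon> by (simp add: field_simps)
  moreover have "1 / Q \<le> \<epsilon>"
  proof -
    have "1 / \<epsilon> \<le> 8 / \<epsilon>" using \<epsilon> by (simp add: field_simps)
    then have "1 / \<epsilon> \<le> Q" using e8 tQ by linarith
    then show ?thesis using tQ t \<epsilon> by (simp add: field_simps)
  qed
  moreover have "96 * Q / (real m ^ 2 * real H ^ 3) \<le> 96 * \<epsilon>"
  proof -
    have "(1 / \<epsilon>) * 1 \<le> real m * real m" using m \<epsilon> by (intro mult_mono) auto
    moreover have "Q \<le> real H ^ 3" using power_mono[OF H(1), of 3] t t3 by simp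
    ultimately have "(1 / \<epsilon>) * Q \<le> real m ^ 2 * real H ^ 3"
      using \<epsilon> tQ t by (intro mult_mono) (auto simp: power2_eq_square)
    then show ?thesis using \<epsilon> m H by (simp add: field_simps)
  qed
  ultimately have norm: "C2_norm (\<lambda>x. \<phi> x - f x) \<le> 100 * \<epsilon>" using f(2) \<epsilon> by linarith
  have "Q powr (2 / 3) = t\<^sup>2"
  proof -
    have "t ^ 3 = t powr 3" "t ^ 2 = t powr 2" using t by (simp_all add: powr_numeral)
    then show ?thesis by (simp add: t3[symmetric] powr_powr)
  qed
  then have count: "\<epsilon> / 64 * Q powr (2 / 3) \<le> card (graph01 f \<inter> scaled_lattice Q)"
    using W(2) f(3) by simp
  have entries: "(mat 1 :: real^2^2) $ i $ j = (if i = j then 1 else 0)" for i j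
    by (simp add: mat_def)
  have id: "(*v) (mat 1 :: real^2^2) ` S = S" for S by simp
  show "\<exists>(g::real^2^2) \<phi>\<^sub>g. g \<in> SL2 \<and>
      (MAX i. MAX j. \<bar>g $ i $ j - (if i = j then 1 else 0)\<bar>) \<le> 100 * \<delta> \<and> C2_01 \<phi>\<^sub>g \<and>
      C2_norm (\<lambda>x. \<phi> x - \<phi>\<^sub>g x) \<le> 100 * \<epsilon> \<and>
      \<epsilon> / 64 * Q powr (2 / 3) \<le> real (card (((*v) g ` graph01 \<phi>\<^sub>g) \<inter> scaled_lattice Q))"
    using f(1) norm count \<delta>
    by (intro exI[of _ "mat 1"] exI[of _ f]) (simp add: id entries SL2_def)
qed auto

end
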